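(* Let $\mathbb{E}$ be a division ring, let $G$ be a finite subgroup of $\mathrm{Aut}(\mathbb{E})$ whose elements are pairwise distinct modulo the group $\mathrm{Inn}(\mathbb{E})$ of inner automorphisms, and let $\mathbb{F}=\mathbb{E}^G$ be the sub-division ring of elements fixed by $G$. Let $\mathfrak{A}$ be an $\mathbb{F}$-algebra, $d\ge1$, and let $\rho\colon\mathfrak{A}\to\mathbb{E}^{d\times d}$ be a representation of $\mathfrak{A}$. Then the following are equivalent: (i) $\rho$ can be written over $\mathbb{F}$, i.e. there exists $A\in\mathrm{GL}_d(\mathbb{E})$ such that $A^{-1}\rho(x)A\in\mathbb{F}^{d\times d}$ for all $x\in\mathfrak{A}$; (ii) there exists a map $C\colon G\to\mathrm{GL}_d(\mathbb{E})$, $\alpha\mapsto C_\alpha$, such that $C_{\alpha\beta}=C_\alpha\,\alpha(C_\beta)$ for all $\alpha,\beta\in G$, and $C_\alpha^{-1}\rho(x)C_\alpha=\alpha(\rho(x))$ for all $\alpha\in G$ and all $x\in\mathfrak{A}$.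
   Context: An automorphism $\alpha$ of $\mathbb{E}$ acts on $d\times d$ matrices over $\mathbb{E}$ entrywise. Automorphisms act on the left, and $\alpha\beta=\alpha\circ\beta$. "Distinct modulo $\mathrm{Inn}(\mathbb{E})$" means that if $\alpha,\beta\in G$ and $\alpha\beta^{-1}$ is an inner automorphism of $\mathbb{E}$, then $\alpha=\beta$. An $\mathbb{F}$-algebra is a ring $\mathfrak{A}$ with a ring homomorphism $\mathbb{F}\to\mathfrak{A}$; a representation is a unital ring homomorphism $\rho\colon\mathfrak{A}\to\mathbb{E}^{d\times d}$ sending the image of $\mu\in\mathbb{F}$ to $\mu I$. *)

theory Defs
  imports "HOL-Analysis.Analysis"
begin

definition ring_aut :: "('e::division_ring \<Rightarrow> 'e) set" where
  "ring_aut = {\<alpha>. bij \<alpha> \<and> \<alpha> 1 = 1 \<and>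
     (\<forall>x y. \<alpha> (x + y) = \<alpha> x + \<alpha> y) \<and> (\<forall>x y. \<alpha> (x * y) = \<alpha> x * \<alpha> y)}"

definition inner_aut :: "('e::division_ring \<Rightarrow> 'e) set" where
  "inner_aut = {\<alpha>. \<exists>u. u \<noteq> 0 \<and> \<alpha> = (\<lambda>x. u * x * inverse u)}"

definition subgroup_of_ring_aut :: "('e::division_ring \<Rightarrow> 'e) set \<Rightarrow> bool" where
  "subgroup_of_ring_aut G \<longleftrightarrow> G \<subseteq> ring_aut \<and> id \<in> G \<and>
     (\<forall>\<alpha>\<in>G. \<forall>\<beta>\<in>G. \<alpha> \<circ> \<beta> \<in> G) \<and> (\<forall>\<alpha>\<in>G. inv \<alpha> \<in> G)"

definition distinct_mod_inner :: "('e::division_ring \<Rightarrow> 'e) set \<Rightarrow> bool" where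
  "distinct_mod_inner G \<longleftrightarrow> (\<forall>\<alpha>\<in>G. \<forall>\<beta>\<in>G. \<alpha> \<circ> inv \<beta> \<in> inner_aut \<longrightarrow> \<alpha> = \<beta>)"

definition fixed_ring :: "('e::division_ring \<Rightarrow> 'e) set \<Rightarrow> 'e set" where
  "fixed_ring G = {x. \<forall>\<alpha>\<in>G. \<alpha> x = x}"

(* The coefficient division ring F is a subset of 'e, so the structure map \<eta> of an F-algebra
   is a function on 'e that is only constrained on F.  Its image need not be central. *)
definition algebra_over :: "'e::division_ring set \<Rightarrow> ('e \<Rightarrow> 'a::ring_1) \<Rightarrow> bool" where
  "algebra_over F \<eta> \<longleftrightarrow> \<eta> 1 = 1 \<and>
     (\<forall>x\<in>F. \<forall>y\<in>F. \<eta> (x + y) = \<eta> x + \<eta> y) \<and> (\<forall>x\<in>F. \<forall>y\<in>F. \<eta> (x * y) = \<eta> x * \<eta> y)"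

definition matrix_representation ::
  "'e::division_ring set \<Rightarrow> ('e \<Rightarrow> 'a::ring_1) \<Rightarrow> ('a \<Rightarrow> 'e^'d^'d) \<Rightarrow> bool" where
  "matrix_representation F \<eta> \<rho> \<longleftrightarrow> \<rho> 1 = mat 1 \<and>
     (\<forall>x y. \<rho> (x + y) = \<rho> x + \<rho> y) \<and> (\<forall>x y. \<rho> (x * y) = \<rho> x ** \<rho> y) \<and>
     (\<forall>\<mu>\<in>F. \<rho> (\<eta> \<mu>) = mat \<mu>)"

definition matrices_over :: "'e set \<Rightarrow> ('e^'d^'d) set" where
  "matrices_over F = {M. \<forall>i j. M $ i $ j \<in> F}"

end

theory Submission
  imports Defs
begin

text \<open>
  If \<open>A\<close> conjugates \<open>\<rho>\<close> into the fixed ring, the coboundary \<open>C \<alpha> = A \<cdot> \<alpha>(A)\<^sup>-\<^sup>1\<close> works. Conversely, a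
  cocycle \<open>C\<close> makes \<open>G\<close> act semilinearly on column vectors by \<open>v \<mapsto> C \<alpha> \<cdot> \<alpha>(v)\<close>, and it suffices to
  find an invertible matrix \<open>A\<close> whose columns are fixed. The traces \<open>\<Sum>\<alpha>. C \<alpha> \<cdot> \<alpha>(v e)\<close> are fixed
  vectors. A row vector annihilating all of them yields a linear relation between the automorphisms,
  so by Dedekind independence (this is where distinctness modulo inner automorphisms enters) it
  is zero. Exchanging columns of the identity matrix one at a time then produces \<open>A\<close>.
\<close>

section \<open>Ring automorphisms and their linear independence\<close>

lemma ring_autD:
  assumes "\<alpha> \<in> ring_aut"
  shows "bij \<alpha>" "\<alpha> 1 = 1" "\<alpha> (x + y) = \<alpha> x + \<alpha> y" "\<alpha> (x * y) = \<alpha> x * \<alpha> y"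
  using assms unfolding ring_aut_def by auto

lemma ring_aut_zero: "\<alpha> \<in> ring_aut \<Longrightarrow> \<alpha> 0 = 0"
  using ring_autD(3)[of \<alpha> 0 0] by simp

lemma ring_aut_sum:
  assumes "\<alpha> \<in> ring_aut"
  shows "\<alpha> (sum f S) = (\<Sum>i\<in>S. \<alpha> (f i))"
  using assms by (induction S rule: infinite_finite_induct) (auto simp: ring_aut_zero ring_autD(3))

lemma distinct_mod_innerD:
  assumes "distinct_mod_inner G" "G \<subseteq> ring_aut" "\<alpha> \<in> G" "\<beta> \<in> G" "u \<noteq> 0"
    and conj: "\<And>x. \<alpha> x = u * \<beta> x * inverse u"
  shows "\<alpha> = \<beta>"
proof -
  have "surj \<beta>"
    using assms(2,4) ring_autD(1) bij_is_surj by blast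
  then have "\<alpha> \<circ> inv \<beta> = (\<lambda>x. u * x * inverse u)"
    by (simp add: fun_eq_iff conj surj_f_inv_f)
  then show ?thesis
    using assms(1,3,4,5) unfolding distinct_mod_inner_def inner_aut_def by blast
qed

text \<open>Two relations with the same \<open>\<beta>\<close>-term are subtracted: one arises by
  substituting \<open>x * e\<close> for \<open>e\<close>, the other by a left multiplication. The
  induction hypothesis kills the coefficients of the difference, and a surviving
  \<open>c \<alpha>\<close> would then make \<open>\<beta>\<close> an inner twist of
  \<open>\<alpha>\<close>.\<close>

lemma dedekind_independence:
  assumes "finite S" "S \<subseteq> G" "G \<subseteq> ring_aut" "distinct_mod_inner G"
    and "\<And>e. (\<Sum>\<alpha>\<in>S. c \<alpha> * \<alpha> e) = 0"
  shows "\<forall>\<alpha>\<in>S. c \<alpha> = 0"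
  using assms(1,2,5)
proof (induction S arbitrary: c rule: finite_induct)
  case empty
  show ?case by simp
next
  case (insert \<beta> S)
  have \<beta>: "\<beta> \<in> ring_aut" and S: "\<And>\<alpha>. \<alpha> \<in> S \<Longrightarrow> \<alpha> \<in> ring_aut"
    using insert.prems(1) assms(3) by auto
  have rel: "c \<beta> * \<beta> e + (\<Sum>\<alpha>\<in>S. c \<alpha> * \<alpha> e) = 0" for e
    using insert.prems(2)[of e] insert.hyps by simp
  show ?case
  proof (cases "c \<beta> = 0")
    case True
    then show ?thesis
      using insert.IH[of c] insert.prems(1) rel by auto
  next
    case False
    have "\<forall>\<alpha>\<in>S. c \<alpha> * \<alpha> x - c \<beta> * \<beta> x * inverse (c \<beta>) * c \<alpha> = 0" for x
    proof (rule insert.IH)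
      fix e
      \<comment> \<open>Chosen so that \<open>?y * c \<beta> = c \<beta> * \<beta> x\<close>:
        multiplying the relation by \<open>?y\<close> on the left yields the same
        \<open>\<beta>\<close>-term as evaluating it at \<open>x * e\<close>. Without commutativity
        this needs the conjugate of \<open>\<beta> x\<close> by \<open>c \<beta>\<close>.\<close>
      let ?y = "c \<beta> * \<beta> x * inverse (c \<beta>)"
      have y\<beta>: "?y * (c \<beta> * \<beta> e) = c \<beta> * \<beta> x * \<beta> e"
        using False by (simp add: mult.assoc) (simp add: mult.assoc[symmetric])
      have "?y * (c \<beta> * \<beta> e) + (\<Sum>\<alpha>\<in>S. ?y * (c \<alpha> * \<alpha> e)) = 0"
        by (simp only: distrib_left[symmetric] sum_distrib_left[symmetric] rel mult_zero_right)
      then have "c \<beta> * \<beta> x * \<beta> e + (\<Sum>\<alpha>\<in>S. ?y * c \<alpha> * \<alpha> e) = 0"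
        by (simp only: y\<beta> mult.assoc[of ?y])
      moreover have "c \<beta> * \<beta> x * \<beta> e + (\<Sum>\<alpha>\<in>S. c \<alpha> * \<alpha> x * \<alpha> e) = 0"
        using rel[of "x * e"] ring_autD(4)[OF \<beta>] ring_autD(4)[OF S]
        by (simp add: mult.assoc)
      ultimately have "(\<Sum>\<alpha>\<in>S. c \<alpha> * \<alpha> x * \<alpha> e) = (\<Sum>\<alpha>\<in>S. ?y * c \<alpha> * \<alpha> e)"
        by (auto simp: add_eq_0_iff)
      then show "(\<Sum>\<alpha>\<in>S. (c \<alpha> * \<alpha> x - ?y * c \<alpha>) * \<alpha> e) = 0"
        by (simp add: left_diff_distrib sum_subtractf)
    qed (use insert.prems(1) in auto)
    then have eq: "c \<alpha> * \<alpha> x = c \<beta> * \<beta> x * inverse (c \<beta>) * c \<alpha>" if "\<alpha> \<in> S" for \<alpha> x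
      using that by simp
    have zero: "c \<alpha> = 0" if "\<alpha> \<in> S" for \<alpha>
    proof (rule ccontr)
      assume nz: "c \<alpha> \<noteq> 0"
      \<comment> \<open>Solving \<open>eq\<close> for \<open>\<beta> x\<close> shows that
        \<open>inverse (c \<beta>) * c \<alpha>\<close> is the conjugating element.\<close>
      have "\<beta> x = (inverse (c \<beta>) * c \<alpha>) * \<alpha> x * inverse (inverse (c \<beta>) * c \<alpha>)" for x
      proof -
        have "(inverse (c \<beta>) * c \<alpha>) * \<alpha> x * inverse (inverse (c \<beta>) * c \<alpha>)
            = inverse (c \<beta>) * (c \<alpha> * \<alpha> x) * (inverse (c \<alpha>) * c \<beta>)"
          using nz False by (simp add: nonzero_inverse_mult_distrib mult.assoc)
        also have "\<dots> = (inverse (c \<beta>) * c \<beta>) * \<beta> x * (inverse (c \<beta>) * (c \<alpha> * inverse (c \<alpha>)) * c \<beta>)"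
          by (simp only: eq[OF that] mult.assoc)
        also have "\<dots> = \<beta> x"
          using nz False by simp
        finally show ?thesis by simp
      qed
      then have "\<beta> = \<alpha>"
        using distinct_mod_innerD[OF assms(4,3), of \<beta> \<alpha> "inverse (c \<beta>) * c \<alpha>"]
          insert.prems(1) that nz False by auto
      with that insert.hyps show False by simp
    qed
    then have "c \<beta> = 0"
      using rel[of 1] ring_autD(2)[OF \<beta>] by simp
    with False show ?thesis by simp
  qed
qed

section \<open>Matrix inverses, entrywise automorphisms and column exchange\<close>

lemma matrix_inv_cancel:
  fixes A :: "'e::semiring_1^'n^'n"
  assumes "invertible A"
  shows "matrix_inv A ** A = mat 1" "A ** matrix_inv A = mat 1"
  using someI_ex[OF assms[unfolded invertible_def]] unfolding matrix_inv_def by auto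

lemma matrix_inv_unique_inverse:
  fixes A B :: "'e::semiring_1^'n^'n"
  assumes "A ** B = mat 1" "B ** A = mat 1"
  shows "matrix_inv A = B"
proof -
  have "invertible A"
    using assms unfolding invertible_def by blast
  then have "matrix_inv A = matrix_inv A ** (A ** B)"
    using assms by simp
  also have "\<dots> = B"
    using matrix_inv_cancel(1)[OF \<open>invertible A\<close>] by (simp add: matrix_mul_assoc)
  finally show ?thesis .
qed

lemma map_matrix_mult:
  assumes "\<alpha> \<in> ring_aut"
  shows "map_matrix \<alpha> (A ** B) = map_matrix \<alpha> A ** map_matrix \<alpha> B"
  using assms
  by (simp add: vec_eq_iff map_matrix_def matrix_matrix_mult_def ring_aut_sum ring_autD(4))

lemma map_matrix_mat_1:
  assumes "\<alpha> \<in> ring_aut"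
  shows "map_matrix \<alpha> (mat 1) = mat 1"
  using assms by (simp add: vec_eq_iff map_matrix_def mat_def ring_aut_zero ring_autD(2))

text \<open>The new matrix is \<open>A ** B\<close>, where \<open>B\<close> is the identity with
  column \<open>j\<close> replaced by the coordinates \<open>u\<close> of \<open>v\<close> with
  respect to the columns of \<open>A\<close>. Such a \<open>B\<close> is invertible once its pivot
  \<open>u $ j\<close> is nonzero; the explicit inverse makes determinants unnecessary.\<close>

lemma invertible_replace_column:
  fixes A :: "'e::division_ring^'n^'n"
  assumes "invertible A" and nz: "(matrix_inv A *v v) $ j \<noteq> 0"
  shows "invertible (\<chi> i k. if k = j then v $ i else A $ i $ k)"
proof -
  define u where "u = matrix_inv A *v v"
  have uj: "u $ j \<noteq> 0"
    using nz by (simp add: u_def)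
  define B :: "'e^'n^'n" where
    "B = (\<chi> i k. if k = j then u $ i else if i = k then 1 else 0)"
  \<comment> \<open>Column elimination with pivot \<open>u $ j\<close>. The pivot is inverted on the
    right of \<open>u $ i\<close>, which makes both products with \<open>B\<close> equal to the
    identity.\<close>
  define B' :: "'e^'n^'n" where
    "B' = (\<chi> i k. if k = j then (if i = j then inverse (u $ j) else - (u $ i * inverse (u $ j)))
                 else if i = k then 1 else 0)"
  \<comment> \<open>Away from column \<open>j\<close> the left factor of each product agrees with
    the identity, so the sum that remains has at most the term \<open>l = i\<close>.\<close>
  have split: "(\<Sum>l\<in>UNIV. f l) = f j + (\<Sum>l\<in>UNIV - {j}. f l)" for f :: "'n \<Rightarrow> 'e"
    by (simp add: sum.remove)
  have "B ** B' = mat 1"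
  proof -
    have "(\<Sum>l\<in>UNIV. B $ i $ l * B' $ l $ k) = mat 1 $ i $ k" for i k
    proof -
      have "(\<Sum>l\<in>UNIV - {j}. B $ i $ l * B' $ l $ k)
          = (\<Sum>l\<in>UNIV - {j}. if l = i then B' $ l $ k else 0)"
        by (rule sum.cong) (auto simp: B_def)
      then show ?thesis
        using uj by (simp add: split) (auto simp: B_def B'_def mat_def)
    qed
    then show ?thesis by (simp add: vec_eq_iff matrix_matrix_mult_def)
  qed
  moreover have "B' ** B = mat 1"
  proof -
    have "(\<Sum>l\<in>UNIV. B' $ i $ l * B $ l $ k) = mat 1 $ i $ k" for i k
    proof -
      have "(\<Sum>l\<in>UNIV - {j}. B' $ i $ l * B $ l $ k)
          = (\<Sum>l\<in>UNIV - {j}. if l = i then B $ l $ k else 0)"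
        by (rule sum.cong) (auto simp: B'_def)
      then show ?thesis
        using uj by (simp add: split) (auto simp: B_def B'_def mat_def mult.assoc)
    qed
    then show ?thesis by (simp add: vec_eq_iff matrix_matrix_mult_def)
  qed
  ultimately have "invertible B"
    unfolding invertible_def by blast
  moreover have "(\<chi> i k. if k = j then v $ i else A $ i $ k) = A ** B"
  proof -
    have "A *v u = v"
      by (simp add: u_def matrix_vector_mul_assoc matrix_inv_cancel(2)[OF assms(1)])
    then have "(\<Sum>l\<in>UNIV. A $ i $ l * u $ l) = v $ i" for i
      by (auto simp: matrix_vector_mult_def)
    moreover have "(\<Sum>l\<in>UNIV. A $ i $ l * (if l = k then 1 else 0)) = A $ i $ k" for i k
      by (simp add: if_distrib cong: if_cong)
    ultimately show ?thesis
      by (auto simp: vec_eq_iff matrix_matrix_mult_def B_def)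
  qed
  ultimately show ?thesis
    using invertible_mult[OF assms(1)] by simp
qed

text \<open>Columns of the identity are exchanged one by one for elements of \<open>W\<close>, which
  the separation hypothesis supplies with nonzero pivot. \<open>W\<close> is a plain set because the
  fixed vectors used below are in general not closed under scaling by the division ring.\<close>

lemma invertible_with_columns_in:
  fixes W :: "('e::division_ring^'n) set"
  assumes sep: "\<And>w :: 'e^'n. (\<And>v. v \<in> W \<Longrightarrow> (\<Sum>i\<in>UNIV. w $ i * v $ i) = 0) \<Longrightarrow> w = 0"
  shows "\<exists>A :: 'e^'n^'n. invertible A \<and> (\<forall>j. column j A \<in> W)"
proof -
  have "\<exists>A :: 'e^'n^'n. invertible A \<and> (\<forall>j\<in>S. column j A \<in> W)" if "finite S" for S :: "'n set"
    using that
  proof (induction S rule: finite_induct)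
    case empty
    have "invertible (mat 1 :: 'e^'n^'n)"
      unfolding invertible_def by (rule exI[of _ "mat 1"]) simp
    then show ?case by blast
  next
    case (insert j S)
    then obtain A :: "'e^'n^'n" where A: "invertible A" "\<forall>k\<in>S. column k A \<in> W"
      by blast
    \<comment> \<open>Pairing row \<open>j\<close> of the inverse with \<open>v\<close> gives entry
      \<open>j\<close> of \<open>matrix_inv A *v v\<close>, which is the pivot of the exchange; so
      this row is the vector to feed to \<open>sep\<close>.\<close>
    have "matrix_inv A $ j \<noteq> 0"
    proof
      assume "matrix_inv A $ j = 0"
      then have "(matrix_inv A ** A) $ j $ j = 0"
        by (simp add: matrix_matrix_mult_def)
      then show False
        by (simp add: matrix_inv_cancel(1)[OF A(1)] mat_def)
    qed
    then obtain v where v: "v \<in> W" "(matrix_inv A *v v) $ j \<noteq> 0"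
      using sep[of "matrix_inv A $ j"] by (auto simp: matrix_vector_mult_def)
    let ?A = "\<chi> i k. if k = j then v $ i else A $ i $ k"
    have "column k ?A = (if k = j then v else column k A)" for k
      by (simp add: column_def vec_eq_iff)
    then have "\<forall>k\<in>insert j S. column k ?A \<in> W"
      using A(2) v(1) by auto
    with invertible_replace_column[OF A(1) v(2)] show ?case by blast
  qed
  from this[of UNIV] show ?thesis by simp
qed

section \<open>Triviality of matrix cocycles\<close>

text \<open>Noncommutative Hilbert 90: the equation for \<open>A\<close> says that \<open>C\<close>
  is the coboundary \<open>A ** matrix_inv (map_matrix \<alpha> A)\<close>. Read column by column,
  it asks for a basis of vectors fixed under the twisted action.\<close>

lemma hilbert_90:
  fixes C :: "('e::division_ring \<Rightarrow> 'e) \<Rightarrow> 'e^'d^'d"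
  assumes G: "subgroup_of_ring_aut G" "finite G" "distinct_mod_inner G"
    and inv: "\<And>\<alpha>. \<alpha> \<in> G \<Longrightarrow> invertible (C \<alpha>)"
    and cocycle: "\<And>\<alpha> \<beta>. \<alpha> \<in> G \<Longrightarrow> \<beta> \<in> G \<Longrightarrow> C (\<alpha> \<circ> \<beta>) = C \<alpha> ** map_matrix \<alpha> (C \<beta>)"
  shows "\<exists>A :: 'e^'d^'d. invertible A \<and> (\<forall>\<alpha>\<in>G. C \<alpha> ** map_matrix \<alpha> A = A)"
proof -
  have aut: "G \<subseteq> ring_aut" and id: "id \<in> G"
    and comp: "\<And>\<alpha> \<beta>. \<alpha> \<in> G \<Longrightarrow> \<beta> \<in> G \<Longrightarrow> \<alpha> \<circ> \<beta> \<in> G"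
    and invG: "\<And>\<alpha>. \<alpha> \<in> G \<Longrightarrow> inv \<alpha> \<in> G"
    using G(1) unfolding subgroup_of_ring_aut_def by auto
  define act where "act \<alpha> v = C \<alpha> *v (\<chi> i. \<alpha> (v $ i))" for \<alpha> and v :: "'e^'d"
  define W where "W = {v. \<forall>\<alpha>\<in>G. act \<alpha> v = v}"
  have act_nth: "act \<alpha> v $ i = (\<Sum>k\<in>UNIV. C \<alpha> $ i $ k * \<alpha> (v $ k))" for \<alpha> v i
    by (simp add: act_def matrix_vector_mult_def)
  \<comment> \<open>The cocycle identity is exactly what turns the twisted maps into an action of
    \<open>G\<close>.\<close>
  have act_comp: "act (\<alpha> \<circ> \<beta>) v = act \<alpha> (act \<beta> v)" if "\<alpha> \<in> G" "\<beta> \<in> G" for \<alpha> \<beta> v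
  proof -
    have \<alpha>: "\<alpha> \<in> ring_aut" using that aut by auto
    have "(\<chi> i. \<alpha> (act \<beta> v $ i)) = map_matrix \<alpha> (C \<beta>) *v (\<chi> i. (\<alpha> \<circ> \<beta>) (v $ i))"
      by (simp add: act_nth vec_eq_iff matrix_vector_mult_def map_matrix_def
          ring_aut_sum[OF \<alpha>] ring_autD(4)[OF \<alpha>])
    then show ?thesis
      unfolding act_def[of \<alpha>] act_def[of "\<alpha> \<circ> \<beta>"] cocycle[OF that]
      by (simp add: matrix_vector_mul_assoc)
  qed
  have act_sum: "act \<alpha> (sum f S) = (\<Sum>x\<in>S. act \<alpha> (f x))" if "\<alpha> \<in> G" for \<alpha> and f :: "_ \<Rightarrow> 'e^'d" and S
  proof -
    have \<alpha>: "\<alpha> \<in> ring_aut" using that aut by auto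
    show ?thesis
      by (simp add: vec_eq_iff act_nth ring_aut_sum[OF \<alpha>] sum_distrib_left) (auto intro: sum.swap)
  qed
  have trace_fixed: "(\<Sum>\<beta>\<in>G. act \<beta> v) \<in> W" for v
  proof -
    have "act \<alpha> (\<Sum>\<beta>\<in>G. act \<beta> v) = (\<Sum>\<beta>\<in>G. act \<beta> v)" if \<alpha>: "\<alpha> \<in> G" for \<alpha>
    proof -
      have bij: "bij \<alpha>" using \<alpha> aut ring_autD(1) by blast
      have "act \<alpha> (\<Sum>\<beta>\<in>G. act \<beta> v) = (\<Sum>\<beta>\<in>G. act (\<alpha> \<circ> \<beta>) v)"
        using \<alpha> by (simp add: act_sum act_comp)
      \<comment> \<open>Left translation by \<open>\<alpha>\<close> permutes
        \<open>G\<close>.\<close>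
      also have "\<dots> = (\<Sum>\<beta>\<in>G. act \<beta> v)"
        using \<alpha> bij bij_is_surj[OF bij] bij_is_inj[OF bij]
        by (intro sum.reindex_bij_witness[of _ "\<lambda>\<beta>. inv \<alpha> \<circ> \<beta>" "\<lambda>\<beta>. \<alpha> \<circ> \<beta>"])
          (auto simp: comp invG fun_eq_iff surj_f_inv_f)
      finally show ?thesis .
    qed
    then show ?thesis by (simp add: W_def)
  qed
  \<comment> \<open>The cocycle identity at \<open>id\<close> makes \<open>C id\<close> idempotent,
    and an invertible idempotent is the identity.\<close>
  have C_id: "C id = mat 1"
  proof -
    have "C id = C id ** C id"
      using cocycle[OF id id] by (simp add: map_matrix_def)
    then have "matrix_inv (C id) ** C id = (matrix_inv (C id) ** C id) ** C id"
      by (metis matrix_mul_assoc)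
    then show ?thesis
      by (simp add: matrix_inv_cancel(1)[OF inv[OF id]])
  qed
  have "w = 0" if w: "\<And>v. v \<in> W \<Longrightarrow> (\<Sum>i\<in>UNIV. w $ i * v $ i) = 0" for w :: "'e^'d"
  proof -
    have "w $ j = 0" for j
    proof -
      \<comment> \<open>Entry \<open>j\<close> of the row vector \<open>w\<close> times
        \<open>C \<alpha>\<close>. Pairing \<open>w\<close> with the trace of
        \<open>axis j e\<close> gives a relation among the automorphisms with these coefficients;
        the one at \<open>id\<close> is \<open>w $ j\<close> itself, by \<open>C_id\<close>.\<close>
      define c where "c \<alpha> = (\<Sum>i\<in>UNIV. w $ i * C \<alpha> $ i $ j)" for \<alpha>
      have "(\<Sum>\<alpha>\<in>G. c \<alpha> * \<alpha> e) = 0" for e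
      proof -
        have act_axis: "act \<alpha> (axis j e) $ i = C \<alpha> $ i $ j * \<alpha> e" if "\<alpha> \<in> G" for \<alpha> i
        proof -
          have "act \<alpha> (axis j e) $ i = (\<Sum>k\<in>UNIV. if k = j then C \<alpha> $ i $ k * \<alpha> e else 0)"
            unfolding act_nth using that aut ring_aut_zero
            by (intro sum.cong) (auto simp: axis_def)
          then show ?thesis by simp
        qed
        have "(\<Sum>\<alpha>\<in>G. c \<alpha> * \<alpha> e) = (\<Sum>\<alpha>\<in>G. \<Sum>i\<in>UNIV. w $ i * act \<alpha> (axis j e) $ i)"
          by (simp add: c_def sum_distrib_right mult.assoc act_axis)
        also have "\<dots> = (\<Sum>i\<in>UNIV. w $ i * (\<Sum>\<alpha>\<in>G. act \<alpha> (axis j e)) $ i)"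
          by (subst sum.swap) (simp add: sum_distrib_left)
        also have "\<dots> = 0"
          by (rule w) (rule trace_fixed)
        finally show ?thesis .
      qed
      then have "c id = 0"
        using dedekind_independence[OF G(2) order_refl aut G(3)] id by blast
      then show ?thesis
        by (simp add: c_def C_id mat_def if_distrib cong: if_cong)
    qed
    then show ?thesis by (simp add: vec_eq_iff)
  qed
  then obtain A :: "'e^'d^'d" where A: "invertible A" "\<forall>j. column j A \<in> W"
    using invertible_with_columns_in[of W] by blast
  have "C \<alpha> ** map_matrix \<alpha> A = A" if "\<alpha> \<in> G" for \<alpha>
  proof -
    have "act \<alpha> (column j A) $ i = column j A $ i" for i j
      using A(2) that by (simp add: W_def)
    then show ?thesis
      by (simp add: vec_eq_iff act_nth column_def matrix_matrix_mult_def map_matrix_def)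
  qed
  with A(1) show ?thesis by blast
qed

section \<open>Passing between rational forms and cocycles\<close>

theorem mainTheorem2:
  fixes G :: "('e::division_ring \<Rightarrow> 'e) set"
    and F :: "'e set"
    and \<eta> :: "'e \<Rightarrow> 'a::ring_1"
    and \<rho> :: "'a \<Rightarrow> 'e^'d^'d"
  assumes "subgroup_of_ring_aut G"
    and "finite G"
    and "distinct_mod_inner G"
    and "F = fixed_ring G"
    and "algebra_over F \<eta>"
    and "matrix_representation F \<eta> \<rho>"
  shows "(\<exists>A :: 'e^'d^'d. invertible A \<and> (\<forall>x. matrix_inv A ** \<rho> x ** A \<in> matrices_over F)) \<longleftrightarrow>
    (\<exists>C :: ('e \<Rightarrow> 'e) \<Rightarrow> 'e^'d^'d.
       (\<forall>\<alpha>\<in>G. invertible (C \<alpha>)) \<and>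
       (\<forall>\<alpha>\<in>G. \<forall>\<beta>\<in>G. C (\<alpha> \<circ> \<beta>) = C \<alpha> ** map_matrix \<alpha> (C \<beta>)) \<and>
       (\<forall>\<alpha>\<in>G. \<forall>x. matrix_inv (C \<alpha>) ** \<rho> x ** C \<alpha> = map_matrix \<alpha> (\<rho> x)))"
    (is "(\<exists>A. ?rational A) \<longleftrightarrow> (\<exists>C. ?cocycle C)")
proof -
  have aut: "\<alpha> \<in> ring_aut" if "\<alpha> \<in> G" for \<alpha>
    using assms(1) that unfolding subgroup_of_ring_aut_def by auto
  \<comment> \<open>Rationality over the fixed ring becomes invariance under the entrywise action,
    the form used in both directions.\<close>
  have over_F_iff: "M \<in> matrices_over F \<longleftrightarrow> (\<forall>\<alpha>\<in>G. map_matrix \<alpha> M = M)" for M :: "'e^'d^'d"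
    by (auto simp: assms(4) matrices_over_def fixed_ring_def map_matrix_def vec_eq_iff)
  show ?thesis
  proof
    assume "\<exists>A. ?rational A"
    then obtain A :: "'e^'d^'d" where A: "invertible A"
      and rat: "\<And>x. matrix_inv A ** \<rho> x ** A \<in> matrices_over F"
      by blast
    define A' where "A' = matrix_inv A"
    note AA' = matrix_inv_cancel[OF A, folded A'_def]
    \<comment> \<open>The trailing factor \<open>M\<close> lets these rules fire inside products
      nested to the right.\<close>
    have cancel: "A' ** (A ** M) = M" "A ** (A' ** M) = M" for M :: "'e^'d^'d"
      by (simp_all add: matrix_mul_assoc AA')
    have map_cancel: "map_matrix \<alpha> A' ** map_matrix \<alpha> A = mat 1"
      "map_matrix \<alpha> A ** map_matrix \<alpha> A' = mat 1"
      "map_matrix \<alpha> A' ** (map_matrix \<alpha> A ** M) = M"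
      "map_matrix \<alpha> A ** (map_matrix \<alpha> A' ** M) = M" if "\<alpha> \<in> G" for \<alpha> and M :: "'e^'d^'d"
      using aut[OF that]
      by (simp_all add: matrix_mul_assoc map_matrix_mult[symmetric] AA' map_matrix_mat_1)
    define C where "C \<alpha> = A ** map_matrix \<alpha> A'" for \<alpha>
    have C_inv: "C \<alpha> ** (map_matrix \<alpha> A ** A') = mat 1" "(map_matrix \<alpha> A ** A') ** C \<alpha> = mat 1"
      if "\<alpha> \<in> G" for \<alpha>
      using that by (simp_all add: C_def matrix_mul_assoc[symmetric] cancel map_cancel AA')
    have "?cocycle C"
    proof (intro conjI ballI allI)
      fix \<alpha> assume \<alpha>: "\<alpha> \<in> G"
      show "invertible (C \<alpha>)"
        using C_inv[OF \<alpha>] unfolding invertible_def by blast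
      show "C (\<alpha> \<circ> \<beta>) = C \<alpha> ** map_matrix \<alpha> (C \<beta>)" for \<beta>
      proof -
        have "map_matrix (\<alpha> \<circ> \<beta>) A' = map_matrix \<alpha> (map_matrix \<beta> A')"
          by (simp add: map_matrix_def vec_eq_iff)
        then show ?thesis
          using \<alpha> by (simp add: C_def map_matrix_mult[OF aut] matrix_mul_assoc[symmetric] map_cancel)
      qed
      show "matrix_inv (C \<alpha>) ** \<rho> x ** C \<alpha> = map_matrix \<alpha> (\<rho> x)" for x
      proof -
        have "matrix_inv (C \<alpha>) ** \<rho> x ** C \<alpha> = map_matrix \<alpha> A ** (A' ** \<rho> x ** A) ** map_matrix \<alpha> A'"
          unfolding matrix_inv_unique_inverse[OF C_inv[OF \<alpha>]]
          by (simp add: C_def matrix_mul_assoc)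
        \<comment> \<open>The conjugated representation has entries in \<open>F\<close>, so applying
          \<open>\<alpha>\<close> to it changes nothing; afterwards the factors
          \<open>\<alpha>(A)\<close> and \<open>\<alpha>(A')\<close> cancel.\<close>
        also have "A' ** \<rho> x ** A = map_matrix \<alpha> (A' ** \<rho> x ** A)"
          using rat[of x] \<alpha> by (simp add: over_F_iff A'_def)
        also have "map_matrix \<alpha> A ** \<dots> ** map_matrix \<alpha> A' = map_matrix \<alpha> (\<rho> x)"
          using \<alpha> by (simp add: map_matrix_mult[OF aut] matrix_mul_assoc[symmetric] map_cancel)
        finally show ?thesis .
      qed
    qed
    then show "\<exists>C. ?cocycle C" by blast
  next
    assume "\<exists>C. ?cocycle C"
    then obtain C :: "('e \<Rightarrow> 'e) \<Rightarrow> 'e^'d^'d" where C: "?cocycle C"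
      by blast
    then obtain A :: "'e^'d^'d" where A: "invertible A" and fixA: "\<And>\<alpha>. \<alpha> \<in> G \<Longrightarrow> C \<alpha> ** map_matrix \<alpha> A = A"
      using hilbert_90[OF assms(1-3), of C] by blast
    define A' where "A' = matrix_inv A"
    note AA' = matrix_inv_cancel[OF A, folded A'_def]
    have "map_matrix \<alpha> (A' ** \<rho> x ** A) = A' ** \<rho> x ** A" if \<alpha>: "\<alpha> \<in> G" for \<alpha> x
    proof -
      define D where "D = matrix_inv (C \<alpha>)"
      have CD: "C \<alpha> ** D = mat 1" "D ** C \<alpha> = mat 1"
        using C \<alpha> matrix_inv_cancel[of "C \<alpha>"] by (auto simp: D_def)
      have mapA: "map_matrix \<alpha> A = D ** A"
        using arg_cong[OF fixA[OF \<alpha>], of "\<lambda>M. D ** M"] by (simp add: matrix_mul_assoc CD)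
      \<comment> \<open>\<open>A' ** C \<alpha>\<close> is a right inverse of \<open>D ** A\<close>,
        which is \<open>\<alpha>(A)\<close>, while \<open>\<alpha>(A')\<close> is a left inverse of
        it; hence the two agree.\<close>
      have mapA': "map_matrix \<alpha> A' = A' ** C \<alpha>"
      proof -
        have "map_matrix \<alpha> A' = map_matrix \<alpha> A' ** (map_matrix \<alpha> A ** (A' ** C \<alpha>))"
          by (simp add: mapA matrix_mul_assoc[symmetric] CD)
            (simp add: matrix_mul_assoc AA' CD)
        also have "\<dots> = map_matrix \<alpha> (A' ** A) ** (A' ** C \<alpha>)"
          by (simp only: map_matrix_mult[OF aut[OF \<alpha>]] matrix_mul_assoc)
        also have "\<dots> = A' ** C \<alpha>"
          by (simp add: AA' map_matrix_mat_1[OF aut[OF \<alpha>]])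
        finally show ?thesis .
      qed
      have "map_matrix \<alpha> (\<rho> x) = D ** \<rho> x ** C \<alpha>"
        using C \<alpha> by (simp add: D_def)
      \<comment> \<open>Applying \<open>\<alpha>\<close> to each of the three factors leaves
        \<open>C \<alpha> ** D\<close> on both sides of \<open>\<rho> x\<close>, and these products
        collapse to the identity.\<close>
      then have "map_matrix \<alpha> (A' ** \<rho> x ** A) = A' ** (C \<alpha> ** D) ** \<rho> x ** (C \<alpha> ** D) ** A"
        by (simp only: map_matrix_mult[OF aut[OF \<alpha>]] mapA mapA' matrix_mul_assoc)
      then show ?thesis by (simp add: CD)
    qed
    with A show "\<exists>A. ?rational A"
      unfolding over_F_iff A'_def by blast
  qed
qed

end
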